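(* Let $H$ be a 3-connected graph and let $\mathcal{T}$ be a set of pairwise vertex-disjoint triangles in $H$ such that every vertex of every triangle in $\mathcal{T}$ has degree 3 in $H$. Then $\mathcal{T}$ is 3-connectivity preserving, i.e. the graph obtained from $H$ by contracting two edges of each triangle in $\mathcal{T}$ is 3-connected.
   Context: Graphs are finite and simple.
   Formalization: Two cases in which the claim fails are excluded: H with 4 vertices (so K_4) and T nonempty, and H with 6 vertices (the triangular prism) and T consisting of two triangles; in both the contracted graph is K_2, which is not 3-connected (3-connected requires more than 3 vertices). *)

theory Defs
  imports "Graph_Theory.Graph_Theory"
begin

text \<open>Finite simple graphs are those \<open>G\<close> with \<open>pair_graph G\<close>: an edge \<open>uv\<close> is the
  pair of arcs \<open>(u,v)\<close>, \<open>(v,u)\<close>, so the degree of \<open>v\<close> is \<open>out_degree G v\<close>.\<close>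

definition k_connected :: "nat \<Rightarrow> 'a pair_pre_digraph \<Rightarrow> bool" where
  "k_connected k G \<longleftrightarrow> pair_graph G \<and> k < card (pverts G) \<and>
     (\<forall>S \<subseteq> pverts G. card S < k \<longrightarrow> connected (with_proj G \<restriction> (pverts G - S)))"

text \<open>A triangle of a simple graph is given by its vertex set.\<close>

definition is_triangle :: "'a pair_pre_digraph \<Rightarrow> 'a set \<Rightarrow> bool" where
  "is_triangle G t \<longleftrightarrow> t \<subseteq> pverts G \<and> card t = 3 \<and>
     (\<forall>u\<in>t. \<forall>v\<in>t. u \<noteq> v \<longrightarrow> (u, v) \<in> parcs G)"

definition triangle_edges :: "'a set \<Rightarrow> 'a set set" where
  "triangle_edges t = {{u, v} | u v. u \<in> t \<and> v \<in> t \<and> u \<noteq> v}"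

text \<open>\<open>G / F\<close> for a set \<open>F\<close> of edges (two-element vertex sets): its vertices are the vertex
  sets of the components of the spanning subgraph with edge set \<open>F\<close>; loops are dropped and
  parallel edges merged, so that the result is again simple.\<close>

definition joined_by :: "'a pair_pre_digraph \<Rightarrow> 'a set set \<Rightarrow> 'a rel" where
  "joined_by G F = {(u, v). u \<in> pverts G \<and> v \<in> pverts G \<and> (u, v) \<in> {(x, y). {x, y} \<in> F}\<^sup>*}"

definition contract_edges :: "'a pair_pre_digraph \<Rightarrow> 'a set set \<Rightarrow> 'a set pair_pre_digraph" where
  "contract_edges G F = \<lparr>
     pverts = pverts G // joined_by G F,
     parcs = {(X, Y). X \<in> pverts G // joined_by G F \<and> Y \<in> pverts G // joined_by G F \<and>
                X \<noteq> Y \<and> (\<exists>x\<in>X. \<exists>y\<in>Y. (x, y) \<in> parcs G)}\<rparr>"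

definition two_edges_of_each :: "'a set set \<Rightarrow> 'a set set \<Rightarrow> bool" where
  "two_edges_of_each T F \<longleftrightarrow> F \<subseteq> (\<Union>t\<in>T. triangle_edges t) \<and>
     (\<forall>t\<in>T. card (F \<inter> triangle_edges t) = 2)"

text \<open>Any two choices of the two edges per triangle yield the same graph; the definition
  quantifies over all of them. For \<open>K\<^sub>4\<close> with one triangle, and for the triangular prism with both of
  its triangles, the contracted graph is \<open>K\<^sub>2\<close>, so there the property fails.\<close>

definition three_connectivity_preserving :: "'a pair_pre_digraph \<Rightarrow> 'a set set \<Rightarrow> bool" where
  "three_connectivity_preserving G T \<longleftrightarrow>
     (\<forall>F. two_edges_of_each T F \<longrightarrow> k_connected 3 (contract_edges G F))"

lemma triangle_edges_3:
  assumes "a \<noteq> b" "b \<noteq> c" "a \<noteq> c"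
  shows "triangle_edges {a, b, c} = {{a, b}, {b, c}, {a, c}}"
  using assms unfolding triangle_edges_def by (auto simp: insert_commute)

text \<open>The quantification above is not vacuous.\<close>

lemma ex_two_edges_of_each:
  assumes "\<And>t. t \<in> T \<Longrightarrow> card t = 3" and "pairwise disjnt T"
  shows "\<exists>F. two_edges_of_each T F"
proof -
  have "\<exists>P. P \<subseteq> triangle_edges t \<and> card P = 2" if tT: "t \<in> T" for t
  proof -
    obtain a b c where t: "t = {a, b, c}" and ne: "a \<noteq> b" "b \<noteq> c" "a \<noteq> c"
      using assms(1)[OF tT] by (auto simp: card_3_iff)
    have "{{a, b}, {b, c}} \<subseteq> triangle_edges t" "card {{a, b}, {b, c}} = 2"
      using ne by (auto simp: t triangle_edges_3 doubleton_eq_iff)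
    then show ?thesis by blast
  qed
  then obtain P where P: "\<And>t. t \<in> T \<Longrightarrow> P t \<subseteq> triangle_edges t \<and> card (P t) = 2"
    by metis
  have disj: "triangle_edges s \<inter> triangle_edges t = {}" if "s \<in> T" "t \<in> T" "s \<noteq> t" for s t
    using pairwiseD[OF assms(2) that] by (fastforce simp: triangle_edges_def disjnt_iff doubleton_eq_iff)
  have "(\<Union>s\<in>T. P s) \<inter> triangle_edges t = P t" if "t \<in> T" for t
    using P disj that by blast
  then have "two_edges_of_each T (\<Union>s\<in>T. P s)"
    using P unfolding two_edges_of_each_def by auto
  then show ?thesis by blast
qed

end

theory Submission
  imports Defs
begin

text \<open>The vertices of the contracted graph are the triangles of \<open>T\<close> and the remaining vertices as
  singletons. If \<open>\<S>\<close> separates it, then the preimages \<open>A\<close>, \<open>B\<close> of the two sides are separated in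
  \<open>H\<close> by \<open>\<Union>\<S>\<close>. Each vertex of a triangle in \<open>\<S>\<close> has at most one neighbour outside it, so one of the
  two sides is met by at most one of the three vertices; the other two can join the opposite side.
  Treating the triangles one after the other leaves a separator of \<open>H\<close> of size at most
  \<open>card \<S> < 3\<close>, a contradiction.

  It remains to see that at least four vertices are left. With at most two, \<open>H\<close> has four vertices
  or consists of two triangles of \<open>T\<close>. With exactly three, call the edges from one block to another
  light if they all leave from one vertex, and heavy otherwise; then a block sends heavy edges to at
  most one of the others, singletons to none. If the other two blocks, not both singletons, sent only
  light edges to a block, the two source vertices would separate \<open>H\<close>. Hence heavy edges enter every
  such block; as lightness between two triangles is symmetric, this is impossible.\<close>

section \<open>Thin blocks: single sources and absorption into a separation\<close>

text \<open>What is kept of a triangle with cubic vertices: two of the three neighbours of each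
  vertex lie inside, so at most one lies outside.\<close>

definition thin_triple :: "'a rel \<Rightarrow> 'a set \<Rightarrow> bool" where
  "thin_triple R t \<longleftrightarrow> card t = 3 \<and>
     (\<forall>v\<in>t. \<forall>x y. x \<notin> t \<longrightarrow> y \<notin> t \<longrightarrow> (v, x) \<in> R \<longrightarrow> (v, y) \<in> R \<longrightarrow> x = y)"

definition thin_block :: "'a rel \<Rightarrow> 'a set \<Rightarrow> bool" where
  "thin_block R t \<longleftrightarrow> card t = 1 \<or> thin_triple R t"

text \<open>The light edges of the overview. The vertex \<open>w\<close> has to exist in
  \<open>X\<close> even if no edge goes to \<open>Y\<close>, since it will be put into a
  separator.\<close>

definition single_source :: "'a rel \<Rightarrow> 'a set \<Rightarrow> 'a set \<Rightarrow> bool" where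
  "single_source R X Y \<longleftrightarrow> (\<exists>w\<in>X. \<forall>x\<in>X. \<forall>y\<in>Y. (x, y) \<in> R \<longrightarrow> x = w)"

text \<open>No vertex of \<open>t\<close> sends edges to both sides. If both alternatives failed,
  two vertices would send edges to \<open>A\<close> and two others to \<open>B\<close>, but
  \<open>t\<close> has only three.\<close>

lemma thin_triple_single_source:
  assumes "thin_triple R t" "A \<inter> B = {}" "t \<inter> A = {}" "t \<inter> B = {}"
  shows "single_source R t A \<or> single_source R t B"
proof (rule ccontr)
  assume neg: "\<not> ?thesis"
  obtain a b c where t: "t = {a, b, c}"
    using assms(1) by (auto simp: thin_triple_def card_3_iff)
  have uniq: "x = y" if "v \<in> t" "x \<notin> t" "y \<notin> t" "(v, x) \<in> R" "(v, y) \<in> R" for v x y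
    using assms(1) that unfolding thin_triple_def by blast
  define P where "P v \<longleftrightarrow> (\<exists>y\<in>A. (v, y) \<in> R)" for v
  define Q where "Q v \<longleftrightarrow> (\<exists>y\<in>B. (v, y) \<in> R)" for v
  have PQ: "\<not> (P v \<and> Q v)" if "v \<in> t" for v
    using uniq[OF that] assms(2-4) unfolding P_def Q_def by blast
  have "\<exists>x\<in>t. x \<noteq> w \<and> P x" "\<exists>x\<in>t. x \<noteq> w \<and> Q x" if "w \<in> t" for w
    using neg that unfolding single_source_def P_def Q_def by blast+
  then show False using PQ unfolding t by (metis insertCI insertE singletonD)
qed

lemma thin_block_single_source:
  assumes "thin_block R t" "A \<inter> B = {}" "t \<inter> A = {}" "t \<inter> B = {}"
  shows "single_source R t A \<or> single_source R t B"
proof (cases "card t = 1")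
  case True
  then show ?thesis by (auto simp: card_1_singleton_iff single_source_def)
next
  case False
  then show ?thesis using assms(1) thin_triple_single_source[OF _ assms(2-4)] unfolding thin_block_def by blast
qed

text \<open>The source \<open>w\<close> has at most one neighbour outside \<open>X\<close>, so at
  most one edge joins \<open>X\<close> and \<open>Y\<close>; its end in \<open>Y\<close> is then the
  only source there. Without such an edge any element of \<open>Y\<close> serves.\<close>

lemma single_source_commute:
  assumes "sym R" "thin_triple R X" "Y \<noteq> {}" "X \<inter> Y = {}" "single_source R X Y"
  shows "single_source R Y X"
proof -
  obtain w where w: "w \<in> X" "\<And>x y. x \<in> X \<Longrightarrow> y \<in> Y \<Longrightarrow> (x, y) \<in> R \<Longrightarrow> x = w"
    using assms(5) by (auto simp: single_source_def)
  have uniq: "x = y" if "x \<notin> X" "y \<notin> X" "(w, x) \<in> R" "(w, y) \<in> R" for x y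
    using assms(2) that w(1) unfolding thin_triple_def by blast
  show ?thesis
  proof (cases "\<exists>y\<in>Y. (w, y) \<in> R")
    case True
    then obtain z where "z \<in> Y" "(w, z) \<in> R" by blast
    then show ?thesis using uniq w symD[OF assms(1)] assms(4) unfolding single_source_def
      by (metis disjoint_iff)
  next
    case False
    then show ?thesis using w symD[OF assms(1)] assms(3) unfolding single_source_def
      by (metis ex_in_conv)
  qed
qed

text \<open>At most one vertex of a thin triple has a neighbour in \<open>A\<close>, or at most one has a neighbour
  in \<open>B\<close>. Keeping that vertex as a separator, the other two can be moved to the opposite side.\<close>

lemma absorb_block:
  assumes "sym R" "R \<inter> A \<times> B = {}" "A \<inter> B = {}" "thin_block R t" "t \<inter> (A \<union> B) = {}"
  shows "\<exists>w\<in>t. \<exists>A' B'. A \<subseteq> A' \<and> B \<subseteq> B' \<and> A' \<inter> B' = {} \<and>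
    A' \<union> B' = A \<union> B \<union> (t - {w}) \<and> R \<inter> A' \<times> B' = {}"
proof -
  have "t \<inter> A = {}" "t \<inter> B = {}" using assms(5) by auto
  from thin_block_single_source[OF assms(4,3) this] show ?thesis
  proof
    assume "single_source R t A"
    then obtain w where w: "w \<in> t" "\<forall>x\<in>t. \<forall>y\<in>A. (x, y) \<in> R \<longrightarrow> x = w"
      by (auto simp: single_source_def)
    have "R \<inter> A \<times> (B \<union> (t - {w})) = {}"
      using w assms(2) symD[OF assms(1)] by blast
    with w(1) show ?thesis
      by (intro bexI[of _ w] exI[of _ A] exI[of _ "B \<union> (t - {w})"]) (use assms in auto)
  next
    assume "single_source R t B"
    then obtain w where w: "w \<in> t" "\<forall>x\<in>t. \<forall>y\<in>B. (x, y) \<in> R \<longrightarrow> x = w"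
      by (auto simp: single_source_def)
    have "R \<inter> (A \<union> (t - {w})) \<times> B = {}"
      using w assms(2) by blast
    with w(1) show ?thesis
      by (intro bexI[of _ w] exI[of _ "A \<union> (t - {w})"] exI[of _ B]) (use assms in auto)
  qed
qed

text \<open>Induction with \<open>absorb_block\<close>: each block leaves one vertex in
  \<open>S\<close>. Disjointness keeps the next block away from the enlarged sides.\<close>

lemma absorb_blocks:
  assumes "finite \<S>" "sym R" "R \<inter> A \<times> B = {}" "A \<inter> B = {}"
    "\<And>t. t \<in> \<S> \<Longrightarrow> thin_block R t" "\<Union>\<S> \<inter> (A \<union> B) = {}" "pairwise disjnt \<S>"
  shows "\<exists>S A' B'. S \<subseteq> \<Union>\<S> \<and> card S \<le> card \<S> \<and> A \<subseteq> A' \<and> B \<subseteq> B' \<and> A' \<inter> B' = {} \<and>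
    A' \<union> B' = A \<union> B \<union> (\<Union>\<S> - S) \<and> R \<inter> A' \<times> B' = {}"
  using assms(1,5-)
proof (induction \<S> rule: finite_induct)
  case empty
  then show ?case using assms(3,4) by (intro exI[of _ "{}"] exI[of _ A] exI[of _ B]) auto
next
  case (insert t \<S>)
  have "\<exists>S A' B'. S \<subseteq> \<Union>\<S> \<and> card S \<le> card \<S> \<and> A \<subseteq> A' \<and> B \<subseteq> B' \<and> A' \<inter> B' = {} \<and>
    A' \<union> B' = A \<union> B \<union> (\<Union>\<S> - S) \<and> R \<inter> A' \<times> B' = {}"
    using insert.prems by (intro insert.IH) (auto simp: pairwise_insert)
  then obtain S A' B' where S: "S \<subseteq> \<Union>\<S>" "card S \<le> card \<S>" "A \<subseteq> A'" "B \<subseteq> B'" "A' \<inter> B' = {}"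
    "A' \<union> B' = A \<union> B \<union> (\<Union>\<S> - S)" "R \<inter> A' \<times> B' = {}" by blast
  have t\<S>: "t \<inter> \<Union>\<S> = {}"
    using insert.prems(3) insert.hyps(2) by (auto simp: pairwise_insert disjnt_def)
  then have "t \<inter> (A' \<union> B') = {}"
    using insert.prems(2) unfolding S(6) by blast
  then obtain w A'' B'' where w: "w \<in> t" "A' \<subseteq> A''" "B' \<subseteq> B''" "A'' \<inter> B'' = {}"
    "A'' \<union> B'' = A' \<union> B' \<union> (t - {w})" "R \<inter> A'' \<times> B'' = {}"
    using absorb_block[OF assms(2) S(7,5), of t] insert.prems(1) by blast
  have "card (insert w S) \<le> card (insert t \<S>)"
    using card_insert_le_m1[of "card (insert t \<S>)" S w] S(2) insert.hyps by simp
  moreover have "A'' \<union> B'' = A \<union> B \<union> (\<Union>(insert t \<S>) - insert w S)"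
    unfolding w(5) S(6) using w(1) S(1) t\<S> by auto
  moreover have "insert w S \<subseteq> \<Union>(insert t \<S>)" "A \<subseteq> A''" "B \<subseteq> B''" using S w by auto
  ultimately show ?case using w(4,6) by blast
qed

section \<open>Connectivity in terms of separations\<close>

lemma connected_induce_iff:
  assumes "pair_graph G" "W \<subseteq> pverts G"
  shows "connected (with_proj G \<restriction> W) \<longleftrightarrow> W \<noteq> {} \<and>
    (\<forall>A B. A \<union> B = W \<longrightarrow> A \<inter> B = {} \<longrightarrow> A \<noteq> {} \<longrightarrow> B \<noteq> {} \<longrightarrow> parcs G \<inter> A \<times> B \<noteq> {})"
proof -
  interpret pair_graph G by fact
  let ?M = "mk_symmetric (with_proj G \<restriction> W)"
  have sym: "(v, u) \<in> parcs G" if "(u, v) \<in> parcs G" for u v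
    using pair_sym_arcs that by (auto simp: symmetric_def dest: symD)
  \<comment> \<open>\<open>connected\<close> refers to the symmetric closure, which adds nothing
    here because the arcs are already symmetric.\<close>
  have arcs: "parcs ?M = parcs G \<inter> W \<times> W"
    using sym by (auto simp: parcs_mk_symmetric)
  interpret M: pair_wf_digraph ?M
    by unfold_locales (auto simp: arcs)
  show ?thesis
  proof (intro iffI conjI allI impI)
    assume "connected (with_proj G \<restriction> W)"
    then have *: "W \<noteq> {}" "\<And>u v. u \<in> W \<Longrightarrow> v \<in> W \<Longrightarrow> u \<rightarrow>\<^sup>*\<^bsub>?M\<^esub> v"
      by (auto simp: connected_def strongly_connected_def)
    show "W \<noteq> {}" by fact
    fix A B assume AB: "A \<union> B = W" "A \<inter> B = {}" "A \<noteq> {}" "B \<noteq> {}"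
    show "parcs G \<inter> A \<times> B \<noteq> {}"
    proof
      assume none: "parcs G \<inter> A \<times> B = {}"
      obtain a b where ab: "a \<in> A" "b \<in> B" using AB by blast
      have "a \<rightarrow>\<^sup>*\<^bsub>?M\<^esub> b" using * ab AB by blast
      \<comment> \<open>No arc inside \<open>W\<close> leaves \<open>A\<close>, so a walk starting
        at \<open>a\<close> stays in \<open>A\<close>.\<close>
      then have "b \<in> A"
      proof (induction rule: M.reachable_induct)
        case base show ?case by fact
      next
        case (step x y)
        then show ?case using none AB arcs by auto
      qed
      with ab AB show False by blast
    qed
  next
    assume *: "W \<noteq> {} \<and> (\<forall>A B. A \<union> B = W \<longrightarrow> A \<inter> B = {} \<longrightarrow> A \<noteq> {} \<longrightarrow> B \<noteq> {} \<longrightarrow>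
      parcs G \<inter> A \<times> B \<noteq> {})"
    have "u \<rightarrow>\<^sup>*\<^bsub>?M\<^esub> v" if uv: "u \<in> W" "v \<in> W" for u v
    proof (rule ccontr)
      assume v: "\<not> u \<rightarrow>\<^sup>*\<^bsub>?M\<^esub> v"
      \<comment> \<open>The part of \<open>W\<close> reachable from \<open>u\<close>; an arc from it
        to the rest would make its head reachable too.\<close>
      define A where "A = {x \<in> W. u \<rightarrow>\<^sup>*\<^bsub>?M\<^esub> x}"
      have "u \<in> A" using uv by (auto simp: A_def)
      moreover have "v \<in> W - A" using uv v by (auto simp: A_def)
      moreover have "A \<subseteq> W" by (auto simp: A_def)
      ultimately have "parcs G \<inter> A \<times> (W - A) \<noteq> {}"
        using *[THEN conjunct2, rule_format, of A "W - A"] by blast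
      then obtain x y where xy: "x \<in> A" "y \<in> W" "y \<notin> A" "(x, y) \<in> parcs G" by blast
      then have "(x, y) \<in> parcs ?M" using \<open>A \<subseteq> W\<close> arcs by auto
      moreover have "u \<rightarrow>\<^sup>*\<^bsub>?M\<^esub> x" using xy(1) by (simp add: A_def)
      ultimately have "u \<rightarrow>\<^sup>*\<^bsub>?M\<^esub> y" by (rule M.reachable_adj_trans[rotated])
      then show False using xy by (auto simp: A_def)
    qed
    then show "connected (with_proj G \<restriction> W)"
      using * by (auto simp: connected_def intro!: strongly_connectedI)
  qed
qed

lemma k_connected_no_small_separation:
  assumes "k_connected k G" "S \<subseteq> pverts G" "card S < k"
    "A \<union> B = pverts G - S" "A \<inter> B = {}" "A \<noteq> {}" "B \<noteq> {}"
  shows "parcs G \<inter> A \<times> B \<noteq> {}"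
  using assms connected_induce_iff[of G "pverts G - S"] unfolding k_connected_def by blast

section \<open>The blocks of the contracted graph\<close>

text \<open>If the edge between \<open>u\<close> and \<open>v\<close> is not chosen, the two chosen
  edges are the other two and form a path through the third vertex.\<close>

lemma two_edges_connect_triangle:
  assumes "two_edges_of_each T F" "t \<in> T" "card t = 3" "u \<in> t" "v \<in> t"
  shows "(u, v) \<in> {(x, y). {x, y} \<in> F}\<^sup>*"
proof (cases "u = v \<or> {u, v} \<in> F")
  case True
  then show ?thesis by auto
next
  case False
  obtain a b c where abc: "t = {a, b, c}" "a \<noteq> b" "b \<noteq> c" "a \<noteq> c"
    using assms(3) by (auto simp: card_3_iff)
  then obtain w where w: "t = {u, w, v}" "u \<noteq> w" "w \<noteq> v" "u \<noteq> v"
    using assms(4,5) False by auto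
  have "F \<inter> triangle_edges t \<subseteq> {{u, w}, {w, v}}"
    using False triangle_edges_3[OF w(2,3,4)] w(1) by auto
  moreover have "card (F \<inter> triangle_edges t) = 2"
    using assms(1,2) by (auto simp: two_edges_of_each_def)
  moreover have "card {{u, w}, {w, v}} = 2"
    using w by (auto simp: doubleton_eq_iff)
  ultimately have "F \<inter> triangle_edges t = {{u, w}, {w, v}}"
    by (intro card_subset_eq) auto
  then have "{u, w} \<in> F" "{w, v} \<in> F" by auto
  then show ?thesis by (auto intro: rtrancl_into_rtrancl)
qed

text \<open>Every edge of \<open>F\<close> lies in a triangle of \<open>T\<close>, and distinct
  triangles share no vertex, so a walk along \<open>F\<close> never changes triangles. In particular
  the classes do not depend on the choice of \<open>F\<close>.\<close>

lemma joined_by_two_edges: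
  assumes "two_edges_of_each T F" "pairwise disjnt T" "\<And>t. t \<in> T \<Longrightarrow> card t = 3"
  shows "joined_by H F =
    {(u, v). u \<in> pverts H \<and> v \<in> pverts H \<and> (u = v \<or> (\<exists>t\<in>T. u \<in> t \<and> v \<in> t))}"
proof -
  have "u = v \<or> (\<exists>t\<in>T. u \<in> t \<and> v \<in> t)" if "(u, v) \<in> {(x, y). {x, y} \<in> F}\<^sup>*" for u v
    using that
  proof (induction rule: rtrancl_induct)
    case (step y z)
    then have "{y, z} \<in> F" by simp
    then obtain t where t: "t \<in> T" "{y, z} \<in> triangle_edges t"
      using assms(1) by (auto simp: two_edges_of_each_def)
    then have "y \<in> t" "z \<in> t" by (auto simp: triangle_edges_def doubleton_eq_iff)
    then show ?case using step.IH t(1) assms(2) unfolding pairwise_def disjnt_iff by metis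
  qed simp
  then show ?thesis
    using two_edges_connect_triangle[OF assms(1) _ assms(3)] unfolding joined_by_def by blast
qed

lemma contract_edges_verts:
  assumes "two_edges_of_each T F" "pairwise disjnt T" "\<And>t. t \<in> T \<Longrightarrow> is_triangle H t"
  shows "pverts (contract_edges H F) = T \<union> (\<lambda>v. {v}) ` (pverts H - \<Union>T)"
proof -
  let ?r = "joined_by H F"
  have card: "card t = 3" "t \<subseteq> pverts H" if "t \<in> T" for t
    using assms(3)[OF that] by (auto simp: is_triangle_def)
  have r: "?r = {(u, v). u \<in> pverts H \<and> v \<in> pverts H \<and> (u = v \<or> (\<exists>t\<in>T. u \<in> t \<and> v \<in> t))}"
    by (rule joined_by_two_edges[OF assms(1,2) card(1)])
  have cls_t: "?r `` {v} = t" if "t \<in> T" "v \<in> t" for t v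
  proof -
    have uniq: "s = t" if "s \<in> T" "v \<in> s" for s
      using assms(2) that \<open>t \<in> T\<close> \<open>v \<in> t\<close> unfolding pairwise_def disjnt_iff by metis
    have "t \<subseteq> pverts H" by (rule card(2)[OF that(1)])
    show ?thesis
    proof (rule set_eqI, rule iffI)
      fix x assume "x \<in> ?r `` {v}"
      then have "x = v \<or> (\<exists>s\<in>T. v \<in> s \<and> x \<in> s)" unfolding r by auto
      then show "x \<in> t" using uniq that by metis
    next
      fix x assume "x \<in> t"
      then show "x \<in> ?r `` {v}" using that \<open>t \<subseteq> pverts H\<close> unfolding r by auto
    qed
  qed
  have cls_v: "?r `` {v} = {v}" if "v \<in> pverts H - \<Union>T" for v
    using that unfolding r by auto
  show ?thesis
  proof (rule set_eqI, rule iffI)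
    fix X assume "X \<in> pverts (contract_edges H F)"
    then obtain v where v: "v \<in> pverts H" "X = ?r `` {v}"
      by (auto simp: contract_edges_def elim: quotientE)
    then show "X \<in> T \<union> (\<lambda>v. {v}) ` (pverts H - \<Union>T)"
      using cls_t cls_v by (cases "v \<in> \<Union>T") auto
  next
    fix X assume X: "X \<in> T \<union> (\<lambda>v. {v}) ` (pverts H - \<Union>T)"
    have "\<exists>v\<in>pverts H. X = ?r `` {v}"
    proof (cases "X \<in> T")
      case True
      then obtain v where "v \<in> X" using card(1)[of X] by fastforce
      then show ?thesis using cls_t[OF True] card(2)[OF True] by blast
    next
      case False
      then show ?thesis using X cls_v by auto
    qed
    then show "X \<in> pverts (contract_edges H F)"
      by (auto simp: contract_edges_def intro: quotientI)
  qed
qed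

text \<open>Two outside neighbours together with the other two vertices of \<open>t\<close> would
  give \<open>v\<close> degree at least four.\<close>

lemma cubic_triangle_thin:
  assumes "pair_graph H" "is_triangle H t" "\<And>v. v \<in> t \<Longrightarrow> out_degree (with_proj H) v = 3"
  shows "thin_triple (parcs H) t"
  unfolding thin_triple_def
proof (intro conjI ballI allI impI)
  show t3: "card t = 3" using assms(2) by (simp add: is_triangle_def)
  fix v x y assume v: "v \<in> t" and xy: "x \<notin> t" "y \<notin> t" "(v, x) \<in> parcs H" "(v, y) \<in> parcs H"
  interpret pair_graph H by fact
  have "finite t" using t3 by (simp add: card_ge_0_finite)
  show "x = y"
  proof (rule ccontr)
    assume "x \<noteq> y"
    have "Pair v ` ({x, y} \<union> (t - {v})) \<subseteq> out_arcs (with_proj H) v"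
      using assms(2) v xy by (auto simp: out_arcs_def is_triangle_def)
    moreover have "finite (out_arcs (with_proj H) v)" by auto
    ultimately have "card (Pair v ` ({x, y} \<union> (t - {v}))) \<le> 3"
      using card_mono assms(3)[OF v] unfolding out_degree_def by metis
    moreover have "card (Pair v ` ({x, y} \<union> (t - {v}))) = card ({x, y} \<union> (t - {v}))"
      by (intro card_image inj_onI) auto
    moreover have "card ({x, y} \<union> (t - {v})) = 4"
      using t3 v xy \<open>x \<noteq> y\<close> \<open>finite t\<close> by (subst card_Un_disjoint) auto
    ultimately show False by simp
  qed
qed

lemma pair_graph_contract_edges:
  assumes "pair_graph H"
  shows "pair_graph (contract_edges H F)"
proof -
  interpret pair_graph H by fact
  have sym: "(v, u) \<in> parcs H" if "(u, v) \<in> parcs H" for u v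
    using pair_sym_arcs that by (auto simp: symmetric_def dest: symD)
  have fin: "finite (pverts H // joined_by H F)"
    by (rule finite_quotient) (auto simp: joined_by_def pair_finite_verts)
  show ?thesis
  proof
    show "finite (parcs (contract_edges H F))"
      by (rule finite_subset[OF _ finite_cartesian_product[OF fin fin]]) (auto simp: contract_edges_def)
    show "symmetric (with_proj (contract_edges H F))"
      using sym by (auto simp: symmetric_def contract_edges_def intro!: symI)
  qed (use fin in \<open>auto simp: contract_edges_def\<close>)
qed

section \<open>Excluding exactly three blocks\<close>

text \<open>The two sources separate \<open>Y\<close> from the rest of \<open>X\<close> and
  \<open>Z\<close>; this rest is nonempty because \<open>X\<close> has a second vertex.\<close>

lemma single_source_same_target:
  assumes "k_connected 3 H" "sym (parcs H)" "pverts H = X \<union> Y \<union> Z"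
    "X \<inter> Y = {}" "X \<inter> Z = {}" "Y \<inter> Z = {}" "2 \<le> card X" "Y \<noteq> {}"
    "single_source (parcs H) X Y" "single_source (parcs H) Z Y"
  shows False
proof -
  obtain w where w: "w \<in> X" "\<forall>x\<in>X. \<forall>y\<in>Y. (x, y) \<in> parcs H \<longrightarrow> x = w"
    using assms(9) by (auto simp: single_source_def)
  obtain z where z: "z \<in> Z" "\<forall>x\<in>Z. \<forall>y\<in>Y. (x, y) \<in> parcs H \<longrightarrow> x = z"
    using assms(10) by (auto simp: single_source_def)
  have "X - {w} \<noteq> {}" using assms(7) card_mono[of "{w}" X] by auto
  then have "parcs H \<inter> ((X - {w}) \<union> (Z - {z})) \<times> Y \<noteq> {}"
    using assms(3-6,8) w(1) z(1)
    by (intro k_connected_no_small_separation[OF assms(1), of "{w, z}"])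
       (auto intro: le_less_trans[OF card_insert_le_m1])
  then show False using w z by blast
qed

lemma not_three_thin_blocks:
  assumes "k_connected 3 H" "sym (parcs H)" "pverts H = X \<union> Y \<union> Z"
    "X \<inter> Y = {}" "X \<inter> Z = {}" "Y \<inter> Z = {}"
    "thin_block (parcs H) X" "thin_block (parcs H) Y" "thin_block (parcs H) Z"
  shows False
proof -
  let ?s = "single_source (parcs H)"
  let ?tri = "thin_triple (parcs H)"
  have ne: "U \<noteq> {}" if "thin_block (parcs H) U" for U
    using that by (auto simp: thin_block_def thin_triple_def)
  have singleton: "?s U W" if "thin_block (parcs H) U" "\<not> ?tri U" for U W
    using that by (auto simp: thin_block_def single_source_def card_1_singleton_iff)
  have tri: "2 \<le> card U" if "?tri U" for U using that by (simp add: thin_triple_def)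
  have one: "?tri X \<or> ?tri Y \<or> ?tri Z"
  proof (rule ccontr)
    assume "\<not> ?thesis"
    then obtain x y z where "X = {x}" "Y = {y}" "Z = {z}"
      using assms(7-9) by (auto simp: thin_block_def card_1_singleton_iff)
    then have "card (pverts H) \<le> 3" using assms(3) by (simp add: card_insert_if)
    then show False using assms(1) by (simp add: k_connected_def)
  qed
  note target = single_source_same_target[OF assms(1,2)]
  \<comment> \<open>\<open>target\<close> wants two vertices in its first block, so it is applied
    with either source block in that place.\<close>
  have X: "\<not> (?s Y X \<and> ?s Z X)" if "?tri Y \<or> ?tri Z"
    using target[of Y X Z] target[of Z X Y] assms(3-6) that tri ne[OF assms(7)] by blast
  have Y: "\<not> (?s X Y \<and> ?s Z Y)" if "?tri X \<or> ?tri Z"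
    using target[of X Y Z] target[of Z Y X] assms(3-6) that tri ne[OF assms(8)] by blast
  have Z: "\<not> (?s X Z \<and> ?s Y Z)" if "?tri X \<or> ?tri Y"
    using target[of X Z Y] target[of Y Z X] assms(3-6) that tri ne[OF assms(9)] by blast
  have choice: "?s X Y \<or> ?s X Z" "?s Y X \<or> ?s Y Z" "?s Z X \<or> ?s Z Y"
    using thin_block_single_source[of "parcs H"] assms(4-9) by (simp_all add: Int_commute)
  have comm: "?tri U \<Longrightarrow> W \<noteq> {} \<Longrightarrow> U \<inter> W = {} \<Longrightarrow> ?s U W \<Longrightarrow> ?s W U" for U W
    by (rule single_source_commute[OF assms(2)])
  have commute: "?tri X \<Longrightarrow> ?s X Y \<Longrightarrow> ?s Y X" "?tri X \<Longrightarrow> ?s X Z \<Longrightarrow> ?s Z X"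
    "?tri Y \<Longrightarrow> ?s Y X \<Longrightarrow> ?s X Y" "?tri Y \<Longrightarrow> ?s Y Z \<Longrightarrow> ?s Z Y"
    "?tri Z \<Longrightarrow> ?s Z X \<Longrightarrow> ?s X Z" "?tri Z \<Longrightarrow> ?s Z Y \<Longrightarrow> ?s Y Z"
    using comm[of X] comm[of Y] comm[of Z] assms(4-6) ne[OF assms(7)] ne[OF assms(8)] ne[OF assms(9)]
    by (simp_all add: Int_commute)
  note single = singleton[OF assms(7)] singleton[OF assms(8)] singleton[OF assms(9)]
  \<comment> \<open>Write U -> W if \<open>?s U W\<close> fails. Singletons emit no arrow, triples
    at most one, and between triples arrows are symmetric. A lone triple would need arrows to both
    singletons. With two triples, one points to the singleton; it also receives an arrow from the
    other triple, hence returns it, and so emits two. With three, the arrows would pair up an odd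
    number of blocks.\<close>
  show False using one X Y Z choice commute single by metis
qed

section \<open>Counting blocks and lifting separations to \<open>H\<close>\<close>

lemma thin_block_nonempty_finite: "thin_block R t \<Longrightarrow> t \<noteq> {} \<and> finite t"
  by (auto simp: thin_block_def thin_triple_def card_ge_0_finite intro!: card_ge_0_finite)

theorem theorem2:
  fixes H :: "'a pair_pre_digraph" and T :: "'a set set"
  assumes "k_connected 3 H"
    and "\<And>t. t \<in> T \<Longrightarrow> is_triangle H t"
    and "pairwise disjnt T"
    and "\<And>t v. t \<in> T \<Longrightarrow> v \<in> t \<Longrightarrow> out_degree (with_proj H) v = 3"
    and not_K4: "\<not> (card (pverts H) = 4 \<and> T \<noteq> {})"
    and not_prism: "\<not> (card (pverts H) = 6 \<and> card T = 2)"
  shows "three_connectivity_preserving H T"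
  unfolding three_connectivity_preserving_def
proof (intro allI impI)
  fix F assume F: "two_edges_of_each T F"
  let ?G = "contract_edges H F"
  have H: "pair_graph H" using assms(1) by (simp add: k_connected_def)
  interpret pair_graph H by fact
  interpret G: pair_graph ?G by (rule pair_graph_contract_edges[OF H])
  have sym: "sym (parcs H)" using pair_sym_arcs by (simp add: symmetric_def)
  have card_V: "3 < card (pverts H)" using assms(1) by (simp add: k_connected_def)
  define Q where "Q = pverts ?G"
  have Q: "Q = T \<union> (\<lambda>v. {v}) ` (pverts H - \<Union>T)"
    unfolding Q_def by (rule contract_edges_verts[OF F assms(3,2)])
  have arcs: "parcs ?G = {(X, Y). X \<in> Q \<and> Y \<in> Q \<and> X \<noteq> Y \<and> (\<exists>x\<in>X. \<exists>y\<in>Y. (x, y) \<in> parcs H)}"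
    by (simp add: Q_def contract_edges_def)
  have finQ: "finite Q" unfolding Q_def by (rule G.pair_finite_verts)
  have UQ: "\<Union>Q = pverts H" using assms(2) unfolding Q is_triangle_def by auto
  have disjQ: "pairwise disjnt Q"
    using assms(3) unfolding Q pairwise_def disjnt_iff by auto
  have cardQ: "card X = (if X \<in> T then 3 else 1)" if "X \<in> Q" for X
    using that assms(2) unfolding Q is_triangle_def by auto
  have thin: "thin_block (parcs H) X" if "X \<in> Q" for X
    using that cubic_triangle_thin[OF H assms(2,4)] unfolding Q thin_block_def by auto
  have disj: "X \<inter> Y = {}" if "X \<in> Q" "Y \<in> Q" "X \<noteq> Y" for X Y
    using disjQ that unfolding pairwise_def disjnt_def by blast
  have "3 < card Q"
  proof (rule ccontr)
    assume "\<not> 3 < card Q"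
    then consider "card Q = 0" | "card Q = 1" | "card Q = 2" | "card Q = 3" by linarith
    then show False
    proof cases
      case 1
      then show False using UQ finQ card_V by auto
    next
      case 2
      then obtain X where "Q = {X}" by (auto simp: card_1_singleton_iff)
      then show False using UQ card_V cardQ[of X] by (auto split: if_splits)
    next
      case 3
      then obtain X Y where XY: "Q = {X, Y}" "X \<noteq> Y" by (auto simp: card_2_iff)
      have sum: "card (pverts H) = card X + card Y"
        using UQ XY disj[of X Y] thin[of X] thin[of Y] thin_block_nonempty_finite
        by (metis Union_insert Union_empty Un_empty_right card_Un_disjoint insertI1 insertI2)
      \<comment> \<open>Two triangles give six vertices, excluded by \<open>not_prism\<close>.
        Otherwise the sizes are 1+1, too few for \<open>card_V\<close>, or 3+1, excluded by
        \<open>not_K4\<close>.\<close>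
      show False
      proof (cases "X \<in> T \<and> Y \<in> T")
        case True
        then have "T = {X, Y}" using Q XY(1) by blast
        then show False using True sum not_prism XY cardQ[of X] cardQ[of Y] by simp
      next
        case False
        then have "card (pverts H) = 4 \<and> T \<noteq> {}"
          using sum card_V XY(1) cardQ[of X] cardQ[of Y] by (auto split: if_splits)
        then show False using not_K4 by blast
      qed
    next
      case 4
      then obtain X Y Z where XYZ: "Q = {X, Y, Z}" "X \<noteq> Y" "Y \<noteq> Z" "X \<noteq> Z"
        by (auto simp: card_3_iff)
      show False
        using XYZ UQ disj thin by (intro not_three_thin_blocks[OF assms(1) sym, of X Y Z]) auto
    qed
  qed
  moreover have "connected (with_proj ?G \<restriction> (Q - \<S>))" if \<S>: "\<S> \<subseteq> Q" "card \<S> < 3" for \<S>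
  proof -
    have "parcs ?G \<inter> \<A> \<times> \<B> \<noteq> {}"
      if AB: "\<A> \<union> \<B> = Q - \<S>" "\<A> \<inter> \<B> = {}" "\<A> \<noteq> {}" "\<B> \<noteq> {}" for \<A> \<B>
    proof
      assume none: "parcs ?G \<inter> \<A> \<times> \<B> = {}"
      have sub: "\<A> \<subseteq> Q" "\<B> \<subseteq> Q" "\<A> \<inter> \<S> = {}" "\<B> \<inter> \<S> = {}" using AB(1) by auto
      have disjU: "\<Union>\<X> \<inter> \<Union>\<Y> = {}" if "\<X> \<subseteq> Q" "\<Y> \<subseteq> Q" "\<X> \<inter> \<Y> = {}" for \<X> \<Y>
        using that disj by blast
      have ne: "\<Union>\<X> \<noteq> {}" if "\<X> \<subseteq> Q" "\<X> \<noteq> {}" for \<X>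
        using that thin thin_block_nonempty_finite by (metis Sup_bot_conv(1) ex_in_conv subsetD)
      have "parcs H \<inter> \<Union>\<A> \<times> \<Union>\<B> = {}"
      proof (rule equals0I, clarify)
        fix x y X Y assume xy: "(x, y) \<in> parcs H" "x \<in> X" "X \<in> \<A>" "y \<in> Y" "Y \<in> \<B>"
        then have "X \<in> Q" "Y \<in> Q" "X \<noteq> Y" using sub AB(2) by blast+
        then have "(X, Y) \<in> parcs ?G" using xy unfolding arcs by blast
        then show False using none xy by blast
      qed
      moreover have "\<Union>\<S> \<inter> (\<Union>\<A> \<union> \<Union>\<B>) = {}"
        using disjU[of \<S> \<A>] disjU[of \<S> \<B>] sub \<S>(1) by blast
      moreover have "thin_block (parcs H) t" if "t \<in> \<S>" for t
        using thin \<S>(1) that by blast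
      \<comment> \<open>The sides are lifted to unions of blocks, and the blocks of \<S> are
        absorbed into them up to one vertex each. Containment of the old sides keeps the new ones
        nonempty.\<close>
      ultimately have "\<exists>S A B. S \<subseteq> \<Union>\<S> \<and> card S \<le> card \<S> \<and> \<Union>\<A> \<subseteq> A \<and> \<Union>\<B> \<subseteq> B \<and>
        A \<inter> B = {} \<and> A \<union> B = \<Union>\<A> \<union> \<Union>\<B> \<union> (\<Union>\<S> - S) \<and> parcs H \<inter> A \<times> B = {}"
        using absorb_blocks[OF finite_subset[OF \<S>(1) finQ] sym _ disjU[OF sub(1,2) AB(2)]]
          pairwise_subset[OF disjQ \<S>(1)] by blast
      then obtain S A B where S: "S \<subseteq> \<Union>\<S>" "card S \<le> card \<S>" "\<Union>\<A> \<subseteq> A" "\<Union>\<B> \<subseteq> B"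
        "A \<inter> B = {}" "A \<union> B = \<Union>\<A> \<union> \<Union>\<B> \<union> (\<Union>\<S> - S)" "parcs H \<inter> A \<times> B = {}"
        by (elim exE conjE) (rule that)
      have "Q = \<A> \<union> \<B> \<union> \<S>" using AB(1) \<S>(1) by blast
      then have V: "pverts H = \<Union>\<A> \<union> \<Union>\<B> \<union> \<Union>\<S>" using UQ by auto
      \<comment> \<open>\<open>S\<close> avoids both lifted sides, so removing it from the last part
        alone is the same as removing it from all of \<open>pverts H\<close>.\<close>
      have "X \<union> Y \<union> (Z - S) = X \<union> Y \<union> Z - S" if "S \<subseteq> Z" "Z \<inter> (X \<union> Y) = {}" for X Y Z
        using that by blast
      from this[OF S(1) \<open>\<Union>\<S> \<inter> (\<Union>\<A> \<union> \<Union>\<B>) = {}\<close>] have "A \<union> B = pverts H - S"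
        unfolding S(6) V .
      moreover have "S \<subseteq> pverts H" using S(1) V by (simp add: le_supI2)
      moreover have "A \<noteq> {}" using ne[OF sub(1) AB(3)] S(3) by (metis subset_empty)
      moreover have "B \<noteq> {}" using ne[OF sub(2) AB(4)] S(4) by (metis subset_empty)
      ultimately have "parcs H \<inter> A \<times> B \<noteq> {}"
        using S(2,5) \<S>(2) by (intro k_connected_no_small_separation[OF assms(1), of S]) auto
      with S(7) show False by blast
    qed
    \<comment> \<open>The empty graph does not count as connected; here more than three blocks exist
      and fewer than three are removed.\<close>
    moreover have "Q - \<S> \<noteq> {}"
      using \<open>3 < card Q\<close> \<S>(2) card_mono[OF finite_subset[OF \<S>(1) finQ], of Q] by auto
    ultimately show ?thesis
      by (subst connected_induce_iff) (auto simp: Q_def G.pair_graph)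
  qed
  ultimately show "k_connected 3 ?G"
    unfolding k_connected_def Q_def[symmetric] using G.pair_graph by blast
qed

end
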